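(* Consider any network on $n$ nodes in which every node has degree at least $0.9395\,(n-1)$. Then any homogeneous Kuramoto model on this network (with any common natural frequency and any coupling constant $k>0$) has no non-zero stable fixed point.
   Context: The Kuramoto model on a finite simple undirected network with nodes $1,\ldots,n$ and symmetric $0/1$ adjacency matrix $A=(A_{ij})$ (with $A_{ii}=0$) is the system $$\dot\theta_i=\omega_i+k\sum_{j=1}^n A_{ij}\sin(\theta_j-\theta_i),\qquad i=1,\ldots,n,$$ where the $\theta_i=\theta_i(t)$ are phase angles (taken over the full circle, i.e. range $-\pi$ to $\pi$, modulo $2\pi$), the real constants $\omega_i$ are natural frequencies, and $k>0$ is the coupling constant. Put $\bar\omega=\frac1n\sum_{j=1}^n\omega_j$. The model is homogeneous if all the $\omega_i$ are equal. The degree of node $i$ is $\sum_{j}A_{ij}$. A fixed point (frequency fixed point) is a solution $\{\theta_i^*\}$ of this system with $\dot\theta_i^*(t)=\bar\omega$ for all $i=1,\ldots,n$ (and all $t$); all phase differences $\Delta^*_{ji}=\theta_j^*(t)-\theta_i^*(t)$ are then constant in time. In the homogeneous case, the phase differences of a fixed point satisfy $\sum_{j=1}^n A_{ij}\sin(\Delta^*_{ji})=0$ for all $i$. The zero fixed point is the fixed point in which all phase angle differences are zero (modulo $2\pi$); a non-zero fixed point is a fixed point in which some phase angle difference is non-zero (modulo $2\pi$). A fixed point is called stable if it is (linearly) stable in the following sense: all eigenvalues of the real symmetric $n\times n$ matrix $M$ with entries $$M_{ij}=A_{ij}\cos(\Delta^*_{ji})-\delta_{ij}\sum_{l=1}^n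 A_{il}\cos(\Delta^*_{li})$$ are less than or equal to zero (here $\delta_{ij}$ is the Kronecker delta). *)

theory Defs
  imports "Jordan_Normal_Form.Char_Poly" "HOL-Library.Real_Mod"
begin

text \<open>
  A network with \<open>n\<close> nodes is given by its adjacency matrix; the nodes are \<open>0, \<dots>, n - 1\<close>,
  following the indexing of matrices.
\<close>

definition network :: "nat \<Rightarrow> real mat \<Rightarrow> bool" where
  "network n A \<longleftrightarrow>
     A \<in> carrier_mat n n \<and>
     (\<forall>i<n. \<forall>j<n. A $$ (i, j) \<in> {0, 1}) \<and>
     (\<forall>i<n. \<forall>j<n. A $$ (i, j) = A $$ (j, i)) \<and>
     (\<forall>i<n. A $$ (i, i) = 0)"

definition degree_of :: "nat \<Rightarrow> real mat \<Rightarrow> nat \<Rightarrow> real" where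
  "degree_of n A i = (\<Sum>j<n. A $$ (i, j))"

text \<open>
  A trajectory assigns to every node a phase angle as a function of time. Phases live on the
  circle; \<open>\<theta> i\<close> is a real-valued lift of the phase of node \<open>i\<close>, so that phase differences are
  only meaningful modulo \<open>2 * pi\<close>.
\<close>

definition kuramoto_solution ::
  "nat \<Rightarrow> real mat \<Rightarrow> (nat \<Rightarrow> real) \<Rightarrow> real \<Rightarrow> (nat \<Rightarrow> real \<Rightarrow> real) \<Rightarrow> bool" where
  "kuramoto_solution n A \<omega> k \<theta> \<longleftrightarrow>
     (\<forall>i<n. \<forall>t. (\<theta> i has_real_derivative
        \<omega> i + k * (\<Sum>j<n. A $$ (i, j) * sin (\<theta> j t - \<theta> i t))) (at t))"

definition homogeneous :: "nat \<Rightarrow> (nat \<Rightarrow> real) \<Rightarrow> bool" where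
  "homogeneous n \<omega> \<longleftrightarrow> (\<forall>i<n. \<forall>j<n. \<omega> i = \<omega> j)"

definition mean_frequency :: "nat \<Rightarrow> (nat \<Rightarrow> real) \<Rightarrow> real" where
  "mean_frequency n \<omega> = (\<Sum>j<n. \<omega> j) / real n"

definition fixed_point ::
  "nat \<Rightarrow> real mat \<Rightarrow> (nat \<Rightarrow> real) \<Rightarrow> real \<Rightarrow> (nat \<Rightarrow> real \<Rightarrow> real) \<Rightarrow> bool" where
  "fixed_point n A \<omega> k \<theta> \<longleftrightarrow>
     kuramoto_solution n A \<omega> k \<theta> \<and>
     (\<forall>i<n. \<forall>t. (\<theta> i has_real_derivative mean_frequency n \<omega>) (at t))"

text \<open>
  The phase differences of a fixed point do not depend on time, so that quantifying over all
  times in \<open>zero_phase_differences\<close> and \<open>linearly_stable\<close> below amounts to looking at any single time.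
\<close>

lemma fixed_point_phase_difference_constant:
  assumes "fixed_point n A \<omega> k \<theta>" "i < n" "j < n"
  shows "\<theta> j t - \<theta> i t = \<theta> j s - \<theta> i s"
proof -
  have "((\<lambda>t. \<theta> j t - \<theta> i t) has_real_derivative 0) (at x)" for x
    using assms by (auto simp: fixed_point_def intro!: derivative_eq_intros)
  then show ?thesis
    using DERIV_isconst_all[of "\<lambda>t. \<theta> j t - \<theta> i t" t s] by blast
qed

definition zero_phase_differences :: "nat \<Rightarrow> (nat \<Rightarrow> real \<Rightarrow> real) \<Rightarrow> bool" where
  "zero_phase_differences n \<theta> \<longleftrightarrow>
     (\<forall>i<n. \<forall>j<n. \<forall>t. [\<theta> j t - \<theta> i t = 0] (rmod (2 * pi)))"

text \<open>Here \<open>\<phi>\<close> are the phases at a single point in time.\<close>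

definition stability_mat :: "nat \<Rightarrow> real mat \<Rightarrow> (nat \<Rightarrow> real) \<Rightarrow> real mat" where
  "stability_mat n A \<phi> = mat n n (\<lambda>(i, j).
     A $$ (i, j) * cos (\<phi> j - \<phi> i)
       - (if i = j then (\<Sum>l<n. A $$ (i, l) * cos (\<phi> l - \<phi> i)) else 0))"

text \<open>The matrix is real symmetric, so all its eigenvalues are real.\<close>

definition linearly_stable :: "nat \<Rightarrow> real mat \<Rightarrow> (nat \<Rightarrow> real \<Rightarrow> real) \<Rightarrow> bool" where
  "linearly_stable n A \<theta> \<longleftrightarrow>
     (\<forall>t. \<forall>\<mu>. eigenvalue (stability_mat n A (\<lambda>i. \<theta> i t)) \<mu> \<longrightarrow> \<mu> \<le> 0)"

end

theory Submission
  imports Defs "HOL-Analysis.Function_Topology"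
begin

text \<open>
  Write \<open>\<phi>\<close> for the phases at one instant, \<open>c\<close> for the cosine of the phase difference of two nodes,
  and \<open>R\<close> for the length of the vector \<open>(\<Sum>j. cos (\<phi> j), \<Sum>j. sin (\<phi> j))\<close>. Stability says
  that the quadratic form \<open>\<Sum>i j. A i j * c * (x i - x j)\<^sup>2\<close> is non-negative
  (\<open>linearly_stable_form_nonneg\<close>), and three uses of this and of the equilibrium equation suffice.

  Taking for \<open>x\<close> the cosines and the sines of the phases and adding gives
  \<open>\<Sum>i j. A i j * c * (1 - c) \<ge> 0\<close>. Few pairs are non-adjacent, so the same sum over all pairs is
  not very negative. It equals \<open>R\<^sup>2 - \<Sum>i j. c\<^sup>2\<close>, and \<open>\<Sum>i j. c\<^sup>2\<close> is at least \<open>n\<^sup>2 / 2\<close>; hence the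
  phases are well aligned: \<open>R\<close> is a definite fraction of \<open>n\<close> (\<open>order_parameter_bound\<close>).

  In the complete network the total force on node \<open>i\<close> would be the pull \<open>- R * sin \<psi>\<close> of the
  mean field, \<open>\<psi>\<close> being the phase of \<open>i\<close> relative to it. The actual force vanishes, so this pull is
  at most the number of missing edges at \<open>i\<close>. As \<open>R\<close> is large, \<open>sin \<psi>\<close> is small: every
  phase is close to the mean phase or to its antipode.

  With degrees at least \<open>0.9395 * (n - 1)\<close> the numbers are \<open>R\<^sup>2 \<ge> 0.379 * n\<^sup>2\<close> and
  \<open>(R * sin \<psi>)\<^sup>2 \<le> (0.0605 * n)\<^sup>2\<close>, which makes \<open>(sin \<psi>)\<^sup>2\<close> less than \<open>1 / 2\<close>; that much ensures that
  phase differences are acute within a cluster and obtuse between the two clusters.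

  Finally take for \<open>x\<close> the indicator function of the antipodal cluster. All edges between the
  clusters contribute negatively, so there are none, and since two distinct nodes are adjacent or have
  a common neighbour (\<open>edge_constant_imp_constant\<close>), one of the clusters is empty. Then all phases
  lie in an open half circle, and a maximum principle (\<open>equilibrium_tan_max\<close>) shows that they agree.
\<close>

section \<open>The largest eigenvalue of a real symmetric matrix\<close>

text \<open>
  The maximum of the Rayleigh quotient is attained by compactness, and a maximiser is an
  eigenvector because the first variation of the quotient vanishes there.
\<close>

lemma positive_eigenvalue_if_form_positive:
  fixes m :: "nat \<Rightarrow> nat \<Rightarrow> real"
  assumes sym: "\<And>i j. i < n \<Longrightarrow> j < n \<Longrightarrow> m i j = m j i"
    and pos: "(\<Sum>i<n. \<Sum>j<n. x i * m i j * x j) > 0"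
  obtains v \<mu> where "\<mu> > 0" "\<exists>i<n. v i \<noteq> 0" "\<And>i. i < n \<Longrightarrow> (\<Sum>j<n. m i j * v j) = \<mu> * v i"
proof -
  define q where "q y = (\<Sum>i<n. \<Sum>j<n. y i * m i j * y j)" for y :: "nat \<Rightarrow> real"
  define s where "s y = (\<Sum>i<n. (y i)\<^sup>2)" for y :: "nat \<Rightarrow> real"
  define nrm where "nrm y = (\<lambda>i. if i < n then y i / sqrt (s y) else 0)" for y :: "nat \<Rightarrow> real"
  define K where "K = PiE UNIV (\<lambda>i. if i < n then {-1..1::real} else {0})"
  define S where "S = K \<inter> {y. s y = 1}"
  have s_nonneg: "s y \<ge> 0" for y
    unfolding s_def by (intro sum_nonneg) auto
  have s_ge: "(y i)\<^sup>2 \<le> s y" if "i < n" for y i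
    unfolding s_def using that by (intro member_le_sum) auto
  have s_zero: "q y = 0" if "s y = 0" for y
  proof -
    have "y i = 0" if "i < n" for i
      using s_ge[OF that, of y] \<open>s y = 0\<close> by simp
    then show ?thesis
      unfolding q_def by (intro sum.neutral ballI) auto
  qed
  have nrm: "nrm y \<in> S \<and> q (nrm y) = q y / s y" if "s y \<noteq> 0" for y
  proof -
    have sp: "s y > 0"
      using that s_nonneg[of y] by simp
    have "s (nrm y) = (\<Sum>i<n. (y i)\<^sup>2 / s y)"
      unfolding s_def[of "nrm y"] using sp
      by (intro sum.cong refl) (simp add: nrm_def power_divide)
    then have "s (nrm y) = 1"
      using that by (simp add: sum_divide_distrib[symmetric] s_def[symmetric])
    moreover have "\<bar>nrm y i\<bar> \<le> 1" if "i < n" for i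
      using s_ge[OF that, of "nrm y"] \<open>s (nrm y) = 1\<close> by (simp add: abs_square_le_1)
    then have "nrm y \<in> K"
      unfolding K_def PiE_UNIV_domain Pi_def by (simp add: abs_le_iff minus_le_iff) (simp add: nrm_def)
    moreover have "q (nrm y) = (\<Sum>i<n. \<Sum>j<n. y i * m i j * y j / s y)"
      unfolding q_def nrm_def using sp
      by (intro sum.cong refl) (simp add: field_simps)
    ultimately show ?thesis
      by (simp add: S_def sum_divide_distrib[symmetric] q_def)
  qed
  have "compactin (product_topology (\<lambda>i. euclidean) UNIV) K"
    unfolding K_def by (subst compactin_PiE) auto
  then have "compact K"
    by (simp add: euclidean_product_topology)
  moreover have "continuous_on UNIV s"
    unfolding s_def by (intro continuous_intros continuous_on_product_coordinates)
  then have "closed {y. s y = 1}"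
    by (intro closed_Collect_eq continuous_on_const)
  ultimately have "compact S"
    unfolding S_def by (rule compact_Int_closed)
  moreover have "s x \<noteq> 0"
    using s_zero[of x] pos by (auto simp: q_def)
  then have "nrm x \<in> S" and qx: "q (nrm x) > 0"
    using nrm[of x] pos s_nonneg[of x] by (auto simp: q_def[symmetric])
  moreover have "continuous_on S q"
    unfolding q_def
    by (intro continuous_intros continuous_on_subset[OF continuous_on_product_coordinates]) auto
  ultimately obtain v where v: "v \<in> S" and vmax: "\<And>y. y \<in> S \<Longrightarrow> q y \<le> q v"
    using continuous_attains_sup[of S q] by blast
  define \<mu> where "\<mu> = q v"
  have sv: "s v = 1"
    using v by (simp add: S_def)
  have "\<mu> > 0"
    using vmax[OF \<open>nrm x \<in> S\<close>] qx by (simp add: \<mu>_def)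
  define b where "b y = \<mu> * s y - q y" for y
  have b_nonneg: "b y \<ge> 0" for y
  proof (cases "s y = 0")
    case True
    then show ?thesis using s_zero[of y] by (simp add: b_def)
  next
    case False
    then have "q y / s y \<le> \<mu>" "s y > 0"
      using nrm[OF False] vmax[of "nrm y"] s_nonneg[of y] by (auto simp: \<mu>_def)
    then show ?thesis by (simp add: b_def field_simps)
  qed
  have bv: "b v = 0"
    by (simp add: b_def sv \<mu>_def)
  \<comment> \<open>The defect of the eigenvector equation is also the direction in which \<open>b\<close> is tested.\<close>
  define g where "g i = \<mu> * v i - (\<Sum>j<n. m i j * v j)" for i
  have b_expand: "b (\<lambda>i. v i + t * g i) = 2 * t * s g + t\<^sup>2 * b g" for t
  proof -
    have s_eq: "s (\<lambda>i. v i + t * g i) = s v + 2 * t * (\<Sum>i<n. g i * v i) + t\<^sup>2 * s g"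
      unfolding s_def sum_distrib_left sum.distrib[symmetric]
      by (intro sum.cong refl) (simp add: power2_eq_square algebra_simps)
    have swap: "(\<Sum>i<n. \<Sum>j<n. v i * m i j * g j) = (\<Sum>i<n. \<Sum>j<n. g i * m i j * v j)"
      by (subst sum.swap) (intro sum.cong refl, simp add: sym)
    have "q (\<lambda>i. v i + t * g i) = q v + t * (\<Sum>i<n. \<Sum>j<n. v i * m i j * g j)
        + t * (\<Sum>i<n. \<Sum>j<n. g i * m i j * v j) + t\<^sup>2 * q g"
      unfolding q_def sum_distrib_left sum.distrib[symmetric]
      by (intro sum.cong refl) (simp add: power2_eq_square algebra_simps)
    then have q_eq: "q (\<lambda>i. v i + t * g i)
        = q v + 2 * t * (\<Sum>i<n. \<Sum>j<n. g i * m i j * v j) + t\<^sup>2 * q g"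
      by (simp add: swap)
    have "s g = (\<Sum>i<n. g i * (\<mu> * v i - (\<Sum>j<n. m i j * v j)))"
      unfolding s_def by (intro sum.cong refl) (simp add: power2_eq_square g_def)
    also have "\<dots> = \<mu> * (\<Sum>i<n. g i * v i) - (\<Sum>i<n. \<Sum>j<n. g i * m i j * v j)"
      by (simp add: right_diff_distrib sum_subtractf sum_distrib_left mult_ac)
    finally have sg: "s g = \<mu> * (\<Sum>i<n. g i * v i) - (\<Sum>i<n. \<Sum>j<n. g i * m i j * v j)" .
    show ?thesis
      using bv unfolding b_def s_eq q_eq by (simp add: sg algebra_simps)
  qed
  \<comment> \<open>As \<open>b\<close> is minimal at \<open>v\<close>, its derivative in direction \<open>g\<close>, which is \<open>2 * s g\<close>, must vanish.\<close>
  have "s g = 0"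
  proof (rule ccontr)
    assume "s g \<noteq> 0"
    then have sp: "s g > 0" using s_nonneg[of g] by simp
    \<comment> \<open>With \<open>1 + b g\<close> in the denominator the linear term beats the quadratic one.\<close>
    define t where "t = - (s g / (1 + b g))"
    have bp: "1 + b g > 0" using b_nonneg[of g] by simp
    have tn: "t < 0" using sp bp by (simp add: t_def)
    have "t * b g = - s g - t"
      using bp by (simp add: t_def field_simps)
    then have "2 * t * s g + t\<^sup>2 * b g = t * (s g - t)"
      by (simp add: power2_eq_square algebra_simps) (simp add: distrib_left[symmetric] mult.left_commute)
    moreover have "t * (s g - t) < 0"
      using tn sp by (simp add: mult_neg_pos)
    ultimately show False
      using b_nonneg[of "\<lambda>i. v i + t * g i"] b_expand[of t] by simp
  qed
  then have "(\<Sum>j<n. m i j * v j) = \<mu> * v i" if "i < n" for i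
    using s_ge[OF that, of g] by (simp add: g_def)
  moreover have "\<exists>i<n. v i \<noteq> 0"
    using sv by (force simp: s_def intro: ccontr)
  ultimately show ?thesis
    using that \<open>\<mu> > 0\<close> by blast
qed

section \<open>Stability as positivity of a quadratic form\<close>

lemma network_entry:
  assumes "network n A" "i < n" "j < n"
  shows "A $$ (i, j) = 0 \<or> A $$ (i, j) = 1" and "A $$ (i, j) = A $$ (j, i)"
  using assms by (auto simp: network_def)

text \<open>
  The stability matrix is minus the Laplacian of the graph with edge weights \<open>A i j * cos (\<phi> j - \<phi> i)\<close>,
  so its form is a weighted sum of squared differences; the factor \<open>1 / 2\<close> accounts
  for each edge occurring in both orientations.
\<close>

lemma stability_form:
  assumes "network n A"
  shows "(\<Sum>i<n. \<Sum>j<n. x i * stability_mat n A \<phi> $$ (i, j) * x j) =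
    - (\<Sum>i<n. \<Sum>j<n. A $$ (i, j) * cos (\<phi> j - \<phi> i) * (x i - x j)\<^sup>2) / 2"
proof -
  define w where "w i j = A $$ (i, j) * cos (\<phi> j - \<phi> i)" for i j
  define d where "d i = (\<Sum>j<n. w i j)" for i
  have w_sym: "w i j = w j i" if "i < n" "j < n" for i j
    using network_entry(2)[OF assms that] cos_minus[of "\<phi> j - \<phi> i"] by (simp add: w_def)
  have "(\<Sum>i<n. \<Sum>j<n. x i * stability_mat n A \<phi> $$ (i, j) * x j)
      = (\<Sum>i<n. \<Sum>j<n. w i j * x i * x j - (if j = i then d i * (x i)\<^sup>2 else 0))"
    by (intro sum.cong refl)
      (auto simp: stability_mat_def w_def d_def power2_eq_square algebra_simps)
  also have "\<dots> = (\<Sum>i<n. \<Sum>j<n. w i j * x i * x j) - (\<Sum>i<n. \<Sum>j<n. w i j * (x i)\<^sup>2)"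
    by (simp add: sum_subtractf sum.delta d_def sum_distrib_right)
  finally have lhs: "(\<Sum>i<n. \<Sum>j<n. x i * stability_mat n A \<phi> $$ (i, j) * x j)
      = (\<Sum>i<n. \<Sum>j<n. w i j * x i * x j) - (\<Sum>i<n. \<Sum>j<n. w i j * (x i)\<^sup>2)" .
  have swap: "(\<Sum>i<n. \<Sum>j<n. w i j * (x j)\<^sup>2) = (\<Sum>i<n. \<Sum>j<n. w i j * (x i)\<^sup>2)"
    by (subst sum.swap) (intro sum.cong refl, simp add: w_sym)
  have "(\<Sum>i<n. \<Sum>j<n. w i j * (x i - x j)\<^sup>2) = (\<Sum>i<n. \<Sum>j<n. w i j * (x i)\<^sup>2)
      + (\<Sum>i<n. \<Sum>j<n. w i j * (x j)\<^sup>2) - 2 * (\<Sum>i<n. \<Sum>j<n. w i j * x i * x j)"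
    unfolding sum_distrib_left sum.distrib[symmetric] sum_subtractf[symmetric]
    by (intro sum.cong refl) (simp add: power2_eq_square algebra_simps)
  then show ?thesis
    unfolding lhs w_def[symmetric] using swap by simp
qed

lemma linearly_stable_form_nonneg:
  assumes net: "network n A" and stable: "linearly_stable n A \<theta>"
  shows "(\<Sum>i<n. \<Sum>j<n. A $$ (i, j) * cos (\<theta> j t - \<theta> i t) * (x i - x j)\<^sup>2) \<ge> 0"
proof (rule ccontr)
  assume neg: "\<not> ?thesis"
  define M where "M = stability_mat n A (\<lambda>i. \<theta> i t)"
  have M: "dim_row M = n" "dim_col M = n"
    by (auto simp: M_def stability_mat_def)
  have M_sym: "M $$ (i, j) = M $$ (j, i)" if "i < n" "j < n" for i j
    using network_entry(2)[OF net that] cos_minus[of "\<theta> j t - \<theta> i t"] that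
    by (simp add: M_def stability_mat_def)
  have "(\<Sum>i<n. \<Sum>j<n. x i * M $$ (i, j) * x j) > 0"
    using neg unfolding M_def stability_form[OF net] by simp
  then obtain v \<mu> where \<mu>: "\<mu> > 0" and v0: "\<exists>i<n. v i \<noteq> 0"
    and ev: "\<And>i. i < n \<Longrightarrow> (\<Sum>j<n. M $$ (i, j) * v j) = \<mu> * v i"
    by (rule positive_eigenvalue_if_form_positive[rotated]) (use M_sym in auto)
  have "vec n v \<noteq> 0\<^sub>v n"
    using v0 by (auto simp: vec_eq_iff)
  moreover have "M *\<^sub>v vec n v = \<mu> \<cdot>\<^sub>v vec n v"
    by (rule eq_vecI) (use M ev in \<open>auto simp: scalar_prod_def atLeast0LessThan\<close>)
  ultimately have "eigenvector M (vec n v) \<mu>"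
    by (simp add: eigenvector_def M)
  then have "eigenvalue M \<mu>"
    by (auto simp: eigenvalue_def)
  then show False
    using stable \<mu> unfolding linearly_stable_def M_def by fastforce
qed

section \<open>Consequences of the degree condition\<close>

text \<open>
  Replacing a sum over the neighbours of \<open>i\<close> by a sum over all nodes costs one term for each
  missing edge at \<open>i\<close>. The node \<open>i\<close> itself costs nothing as \<open>g i = 0\<close>, which is why the bound has
  \<open>n - 1\<close> in place of \<open>n\<close>.
\<close>

lemma sum_neighbours_approx:
  assumes net: "network n A" and i: "i < n" and deg: "degree_of n A i \<ge> \<mu> * (real n - 1)"
    and gi: "g i = 0" and g: "\<And>j. j < n \<Longrightarrow> \<bar>g j\<bar> \<le> B"
  shows "\<bar>(\<Sum>j<n. g j) - (\<Sum>j<n. A $$ (i, j) * g j)\<bar> \<le> B * ((1 - \<mu>) * (real n - 1))"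
proof -
  have B: "B \<ge> 0"
    using g[OF i] gi by simp
  have "(\<Sum>j<n. g j) - (\<Sum>j<n. A $$ (i, j) * g j) = (\<Sum>j<n. (1 - A $$ (i, j)) * g j)"
    by (simp add: sum_subtractf left_diff_distrib)
  also have "\<bar>\<dots>\<bar> \<le> (\<Sum>j<n. \<bar>(1 - A $$ (i, j)) * g j\<bar>)"
    by (rule sum_abs)
  also have "\<dots> \<le> (\<Sum>j<n. B * (1 - A $$ (i, j) - (if j = i then 1 else 0)))"
  proof (rule sum_mono)
    fix j assume "j \<in> {..<n}"
    then have j: "j < n" by simp
    show "\<bar>(1 - A $$ (i, j)) * g j\<bar> \<le> B * (1 - A $$ (i, j) - (if j = i then 1 else 0))"
    proof (cases "j = i")
      case True
      then show ?thesis using net i gi by (simp add: network_def)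
    next
      case False
      then show ?thesis using network_entry(1)[OF net i j] g[OF j] by auto
    qed
  qed
  also have "\<dots> = B * (real n - degree_of n A i - 1)"
    using i by (simp add: sum_distrib_left[symmetric] sum_subtractf degree_of_def)
  also have "\<dots> \<le> B * ((1 - \<mu>) * (real n - 1))"
    using deg B by (intro mult_left_mono) (auto simp: algebra_simps)
  finally show ?thesis .
qed

text \<open>
  When all degrees exceed \<open>(n - 1) / 2\<close>, the neighbourhoods of two non-adjacent nodes,
  which avoid both nodes, must intersect.
\<close>

lemma edge_constant_imp_constant:
  assumes net: "network n A" and deg: "\<And>i. i < n \<Longrightarrow> degree_of n A i > (real n - 1) / 2"
    and edge: "\<And>i j. i < n \<Longrightarrow> j < n \<Longrightarrow> A $$ (i, j) = 1 \<Longrightarrow> f i = f j"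
    and i: "i < n" and j: "j < n"
  shows "f i = f j"
proof (rule ccontr)
  assume ne: "f i \<noteq> f j"
  have "degree_of n A i + degree_of n A j = (\<Sum>l<n. A $$ (i, l) + A $$ (j, l))"
    by (simp add: degree_of_def sum.distrib)
  also have "\<dots> \<le> (\<Sum>l<n. 1 - (if l = i then 1 else 0))"
  proof (rule sum_mono)
    fix l assume "l \<in> {..<n}"
    then have l: "l < n" by simp
    have "A $$ (i, l) \<noteq> 1 \<or> A $$ (j, l) \<noteq> 1"
      using edge[OF i l] edge[OF j l] ne by auto
    moreover have "A $$ (j, i) = 0"
      using edge[OF j i] network_entry(1)[OF net j i] ne by auto
    ultimately show "A $$ (i, l) + A $$ (j, l) \<le> 1 - (if l = i then 1 else 0)"
      using network_entry(1)[OF net i l] network_entry(1)[OF net j l] net i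
      by (auto simp: network_def)
  qed
  also have "\<dots> = real n - 1"
    using i by (simp add: sum_subtractf)
  finally show False
    using deg[OF i] deg[OF j] by simp
qed

section \<open>Alignment of the phases\<close>

text \<open>Both sides are the squared modulus of \<open>\<Sum>j. exp (\<i> * f j)\<close>.\<close>

lemma sum_cos_diff:
  fixes f :: "nat \<Rightarrow> real"
  shows "(\<Sum>i<n. \<Sum>j<n. cos (f j - f i)) = (\<Sum>j<n. cos (f j))\<^sup>2 + (\<Sum>j<n. sin (f j))\<^sup>2"
  by (simp add: cos_diff sum.distrib power2_eq_square sum_product mult.commute)

text \<open>
  The cosines and the sines of the phases are the coordinates of points on the unit circle, and
  the squared chord between two of them is \<open>2 * (1 - c)\<close>. So the form at these two vectors adds up to
  twice the sum of \<open>c * (1 - c)\<close> over the edges, where \<open>\<bar>c * (1 - c)\<bar> \<le> 2\<close> bounds the cost of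
  passing to all pairs. The mean of \<open>c\<^sup>2\<close> over all pairs is at least \<open>1 / 2\<close> because
  \<open>2 * c\<^sup>2 - 1\<close> is the cosine of the doubled difference, and \<open>sum_cos_diff\<close> applied to the doubled
  phases is non-negative.
\<close>

lemma order_parameter_bound:
  assumes net: "network n A" and deg: "\<And>i. i < n \<Longrightarrow> degree_of n A i \<ge> \<mu> * (real n - 1)"
    and form: "\<And>x. (\<Sum>i<n. \<Sum>j<n. A $$ (i, j) * cos (\<phi> j - \<phi> i) * (x i - x j)\<^sup>2) \<ge> 0"
  shows "(\<Sum>j<n. cos (\<phi> j))\<^sup>2 + (\<Sum>j<n. sin (\<phi> j))\<^sup>2
    \<ge> (real n)\<^sup>2 / 2 - 2 * (1 - \<mu>) * real n * (real n - 1)"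
proof -
  define c where "c i j = cos (\<phi> j - \<phi> i)" for i j
  define g where "g i j = c i j * (1 - c i j)" for i j
  have c_abs: "\<bar>c i j\<bar> \<le> 1" for i j
    by (simp add: c_def)
  have g_abs: "\<bar>g i j\<bar> \<le> 2" for i j
  proof -
    have "\<bar>c i j\<bar> * \<bar>1 - c i j\<bar> \<le> 1 * 2"
      using c_abs[of i j] by (intro mult_mono) auto
    then show ?thesis by (simp add: g_def abs_mult)
  qed
  have "(cos a - cos b)\<^sup>2 + (sin a - sin b)\<^sup>2 = 2 * (1 - cos (b - a))" for a b :: real
    using sin_cos_squared_add[of a] sin_cos_squared_add[of b]
    by (simp add: cos_diff power2_eq_square algebra_simps)
  then have chord: "c i j * ((cos (\<phi> i) - cos (\<phi> j))\<^sup>2 + (sin (\<phi> i) - sin (\<phi> j))\<^sup>2) = 2 * g i j"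
    for i j
    by (simp add: c_def g_def)
  have "0 \<le> (\<Sum>i<n. \<Sum>j<n. A $$ (i, j) * c i j * (cos (\<phi> i) - cos (\<phi> j))\<^sup>2)
      + (\<Sum>i<n. \<Sum>j<n. A $$ (i, j) * c i j * (sin (\<phi> i) - sin (\<phi> j))\<^sup>2)"
    using form[of "\<lambda>i. cos (\<phi> i)"] form[of "\<lambda>i. sin (\<phi> i)"] by (simp add: c_def)
  also have "\<dots> = (\<Sum>i<n. \<Sum>j<n. 2 * (A $$ (i, j) * g i j))"
    unfolding sum.distrib[symmetric]
    by (intro sum.cong refl) (simp add: mult.assoc distrib_left[symmetric] chord)
  also have "\<dots> = 2 * (\<Sum>i<n. \<Sum>j<n. A $$ (i, j) * g i j)"
    by (simp add: sum_distrib_left)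
  finally have "0 \<le> (\<Sum>i<n. \<Sum>j<n. A $$ (i, j) * g i j)"
    by simp
  also have "\<dots> \<le> (\<Sum>i<n. (\<Sum>j<n. g i j) + 2 * ((1 - \<mu>) * (real n - 1)))"
  proof (rule sum_mono)
    fix i assume "i \<in> {..<n}"
    then have "\<bar>(\<Sum>j<n. g i j) - (\<Sum>j<n. A $$ (i, j) * g i j)\<bar> \<le> 2 * ((1 - \<mu>) * (real n - 1))"
      using g_abs by (intro sum_neighbours_approx[OF net _ deg]) (auto simp: g_def c_def)
    then show "(\<Sum>j<n. A $$ (i, j) * g i j) \<le> (\<Sum>j<n. g i j) + 2 * ((1 - \<mu>) * (real n - 1))"
      by linarith
  qed
  also have "\<dots> = (\<Sum>i<n. \<Sum>j<n. g i j) + 2 * (1 - \<mu>) * real n * (real n - 1)"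
    by (simp add: sum.distrib)
  finally have total: "0 \<le> (\<Sum>i<n. \<Sum>j<n. g i j) + 2 * (1 - \<mu>) * real n * (real n - 1)" .
  have "(\<Sum>i<n. \<Sum>j<n. g i j) = (\<Sum>i<n. \<Sum>j<n. c i j) - (\<Sum>i<n. \<Sum>j<n. (c i j)\<^sup>2)"
    by (simp add: g_def right_diff_distrib sum_subtractf power2_eq_square)
  moreover have "(\<Sum>i<n. \<Sum>j<n. (c i j)\<^sup>2) \<ge> (real n)\<^sup>2 / 2"
  proof -
    have "(c i j)\<^sup>2 = 1 / 2 + cos (2 * \<phi> j - 2 * \<phi> i) / 2" for i j
      using cos_double_cos[of "\<phi> j - \<phi> i"] by (simp add: c_def right_diff_distrib diff_divide_distrib)
    then have "(\<Sum>i<n. \<Sum>j<n. (c i j)\<^sup>2)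
        = (real n)\<^sup>2 / 2 + (\<Sum>i<n. \<Sum>j<n. cos (2 * \<phi> j - 2 * \<phi> i)) / 2"
      by (simp add: sum.distrib sum_divide_distrib power2_eq_square)
    then show ?thesis
      unfolding sum_cos_diff by simp
  qed
  ultimately show ?thesis
    using total sum_cos_diff[where f = \<phi> and n = n] by (simp add: c_def)
qed

section \<open>Equilibria in an open half circle\<close>

text \<open>
  When all phases lie in one open half circle, a node whose phase is extremal feels forces of one
  sign only, so these all vanish. Comparing tangents instead of phases makes the argument
  insensitive to the choice of lifts: \<open>sin (\<psi> j - \<psi> i) = cos (\<psi> i) * cos (\<psi> j) * (tan (\<psi> j) - tan (\<psi> i))\<close>.
\<close>

lemma equilibrium_tan_max:
  assumes net: "network n A" and i: "i < n"
    and cos_pos: "\<And>j. j < n \<Longrightarrow> cos (\<psi> i) * cos (\<psi> j) > 0"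
    and eq: "(\<Sum>j<n. A $$ (i, j) * sin (\<psi> j - \<psi> i)) = 0"
    and max: "\<And>j. j < n \<Longrightarrow> tan (\<psi> j) \<le> tan (\<psi> i)"
    and j: "j < n" and adj: "A $$ (i, j) = 1"
  shows "tan (\<psi> j) = tan (\<psi> i)"
proof -
  define h where "h l = A $$ (i, l) * (cos (\<psi> i) * cos (\<psi> l) * (tan (\<psi> l) - tan (\<psi> i)))" for l
  have "sin (\<psi> l - \<psi> i) = cos (\<psi> i) * cos (\<psi> l) * (tan (\<psi> l) - tan (\<psi> i))" if "l < n" for l
    using cos_pos[OF that] by (auto simp: sin_diff tan_def field_simps)
  then have "(\<Sum>l<n. h l) = 0"
    using eq by (simp add: h_def)
  have A0: "A $$ (i, l) \<ge> 0" if "l < n" for l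
    using network_entry(1)[OF net i that] by auto
  have "h l \<le> 0" if "l < n" for l
    unfolding h_def using A0[OF that] cos_pos[OF that] max[OF that]
    by (intro mult_nonneg_nonpos) auto
  then have "h j = 0"
    using \<open>(\<Sum>l<n. h l) = 0\<close> sum_nonneg_eq_0_iff[of "{..<n}" "\<lambda>l. - h l"] j
    by (auto simp: sum_negf)
  then show ?thesis
    using adj cos_pos[OF j] by (auto simp: h_def)
qed

section \<open>Dense networks\<close>

theorem theorem4p2:
  fixes n :: nat and A :: "real mat" and \<omega> :: "nat \<Rightarrow> real" and k :: real
  assumes "network n A"
    and "\<forall>i<n. degree_of n A i \<ge> 0.9395 * (real n - 1)"
    and "homogeneous n \<omega>"
    and "k > 0"
  shows "\<not> (\<exists>\<theta>. fixed_point n A \<omega> k \<theta> \<and> \<not> zero_phase_differences n \<theta> \<and> linearly_stable n A \<theta>)"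
proof -
  note net = assms(1)
  have deg: "degree_of n A i \<ge> 0.9395 * (real n - 1)" if "i < n" for i
    using assms(2) that by blast
  have zero: "zero_phase_differences n \<theta>"
    if fp: "fixed_point n A \<omega> k \<theta>" and stable: "linearly_stable n A \<theta>" for \<theta>
    unfolding zero_phase_differences_def
  proof (intro allI impI)
    fix i0 j0 t assume i0: "i0 < n" and j0: "j0 < n"
    show "[\<theta> j0 t - \<theta> i0 t = 0] (rmod (2 * pi))"
    proof (cases "i0 = j0")
      case False
      then have n2: "n \<ge> 2"
        using i0 j0 by linarith
      have deg_half: "degree_of n A i > (real n - 1) / 2" if "i < n" for i
        using deg[OF that] n2 by simp
      note edge_const = edge_constant_imp_constant[OF net deg_half]
      define \<phi> where "\<phi> i = \<theta> i t" for i
      have eq: "(\<Sum>j<n. A $$ (i, j) * sin (\<phi> j - \<phi> i)) = 0" if i: "i < n" for i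
      proof -
        have "\<omega> j = \<omega> i" if "j < n" for j
          using assms(3) i that unfolding homogeneous_def by blast
        then have "mean_frequency n \<omega> = \<omega> i"
          using n2 by (simp add: mean_frequency_def)
        moreover have "\<omega> i + k * (\<Sum>j<n. A $$ (i, j) * sin (\<phi> j - \<phi> i)) = mean_frequency n \<omega>"
          using fp i unfolding fixed_point_def kuramoto_solution_def \<phi>_def
          by (blast intro: DERIV_unique)
        ultimately show ?thesis
          using assms(4) by simp
      qed
      have form: "(\<Sum>i<n. \<Sum>j<n. A $$ (i, j) * cos (\<phi> j - \<phi> i) * (x i - x j)\<^sup>2) \<ge> 0" for x
        unfolding \<phi>_def by (rule linearly_stable_form_nonneg[OF net stable])

      \<comment> \<open>\<open>\<alpha>\<close> is the direction of the mean field, up to the sign of \<open>R\<close>.\<close>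
      obtain R \<alpha> where R: "(\<Sum>j<n. cos (\<phi> j)) = R * cos \<alpha>" "(\<Sum>j<n. sin (\<phi> j)) = R * sin \<alpha>"
        using polar_Ex by blast
      have "R\<^sup>2 = (\<Sum>j<n. cos (\<phi> j))\<^sup>2 + (\<Sum>j<n. sin (\<phi> j))\<^sup>2"
        by (simp add: R power_mult_distrib distrib_left[symmetric])
      also have "\<dots> \<ge> (real n)\<^sup>2 / 2 - 2 * (1 - 0.9395) * real n * (real n - 1)"
        by (rule order_parameter_bound[OF net deg form])
      finally have "R\<^sup>2 \<ge> (real n)\<^sup>2 / 2 - 2 * (1 - 0.9395) * (real n * (real n - 1))"
        by (simp only: mult.assoc)
      moreover have "real n * (real n - 1) \<le> (real n)\<^sup>2"
        by (simp add: power2_eq_square algebra_simps)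
      ultimately have R2: "R\<^sup>2 \<ge> 0.379 * (real n)\<^sup>2"
        by (simp add: field_simps)

      define \<psi> where "\<psi> i = \<phi> i - \<alpha>" for i
      have \<psi>_diff: "\<psi> j - \<psi> i = \<phi> j - \<phi> i" for i j
        by (simp add: \<psi>_def)
      have sin_small: "(sin (\<psi> i))\<^sup>2 < 1 / 2" if i: "i < n" for i
      proof -
        have "(\<Sum>j<n. sin (\<phi> j - \<phi> i))
            = (\<Sum>j<n. sin (\<phi> j)) * cos (\<phi> i) - (\<Sum>j<n. cos (\<phi> j)) * sin (\<phi> i)"
          by (simp add: sin_diff sum_subtractf sum_distrib_right)
        also have "\<dots> = - (R * sin (\<psi> i))"
          unfolding R by (simp add: \<psi>_def sin_diff algebra_simps)
        finally have "(\<Sum>j<n. sin (\<phi> j - \<phi> i)) = - (R * sin (\<psi> i))" .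
        moreover have "\<bar>(\<Sum>j<n. sin (\<phi> j - \<phi> i)) - (\<Sum>j<n. A $$ (i, j) * sin (\<phi> j - \<phi> i))\<bar>
            \<le> 1 * ((1 - 0.9395) * (real n - 1))"
          by (rule sum_neighbours_approx[OF net i deg[OF i]]) auto
        ultimately have "\<bar>R * sin (\<psi> i)\<bar> \<le> 0.0605 * real n"
          using eq[OF i] by simp
        then have "(R * sin (\<psi> i))\<^sup>2 \<le> (0.0605 * real n)\<^sup>2"
          by (subst power2_abs[symmetric]) (rule power_mono, auto)
        moreover have "0.379 * (real n)\<^sup>2 * (sin (\<psi> i))\<^sup>2 \<le> (R * sin (\<psi> i))\<^sup>2"
          unfolding power_mult_distrib by (rule mult_right_mono[OF R2]) simp
        ultimately have "0.379 * (real n)\<^sup>2 * (sin (\<psi> i))\<^sup>2 \<le> (0.0605 * real n)\<^sup>2"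
          by linarith
        then have "(real n)\<^sup>2 * (0.379 * (sin (\<psi> i))\<^sup>2) \<le> (real n)\<^sup>2 * 0.0605\<^sup>2"
          by (simp only: power_mult_distrib mult_ac)
        then show ?thesis
          using n2 by (subst (asm) mult_le_cancel_left_pos) (simp_all add: power_divide)
      qed
      have cos_large: "(cos (\<psi> i))\<^sup>2 > 1 / 2" if "i < n" for i
        using sin_small[OF that] sin_cos_squared_add[of "\<psi> i"] by linarith
      \<comment> \<open>In the addition formula the product of cosines dominates the product of sines.\<close>
      have cos_diff_sign: "cos (\<phi> j - \<phi> i) * (cos (\<psi> i) * cos (\<psi> j)) > 0"
        if "i < n" "j < n" for i j
      proof -
        define C S where "C = cos (\<psi> i) * cos (\<psi> j)" and "S = sin (\<psi> i) * sin (\<psi> j)"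
        have "S\<^sup>2 \<le> 1 / 2 * (1 / 2)"
          unfolding S_def power_mult_distrib
          using sin_small that by (intro mult_mono) (auto simp: less_imp_le)
        also have "\<dots> < C\<^sup>2"
          unfolding C_def power_mult_distrib
          using cos_large[OF that(1)] cos_large[OF that(2)] by (intro mult_strict_mono) auto
        finally have "\<bar>S\<bar> < \<bar>C\<bar>"
          by (metis abs_le_square_iff not_le)
        then have "(C + S) * C > 0"
          by (cases "C > 0") (auto simp: zero_less_mult_iff)
        then show ?thesis
          unfolding \<psi>_diff[symmetric] cos_diff C_def S_def by (simp add: mult_ac add_ac)
      qed

      \<comment> \<open>The test vector is the indicator of one of the two antipodal clusters.\<close>
      define x where "x i = (if cos (\<psi> i) < 0 then 1 else 0 :: real)" for i
      have x_edge: "x i = x j" if i: "i < n" and j: "j < n" and adj: "A $$ (i, j) = 1" for i j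
      proof (rule ccontr)
        assume ne: "x i \<noteq> x j"
        define w where "w i j = A $$ (i, j) * cos (\<phi> j - \<phi> i) * (x i - x j)\<^sup>2" for i j
        have cross_neg: "cos (\<phi> j - \<phi> i) < 0" if "i < n" "j < n" "x i \<noteq> x j" for i j
        proof -
          have "cos (\<psi> i) * cos (\<psi> j) \<le> 0"
            using that(3) by (auto simp: x_def mult_le_0_iff split: if_splits)
          then show ?thesis
            using cos_diff_sign[OF that(1,2)]
            unfolding zero_less_mult_iff[of "cos (\<phi> j - \<phi> i)"] by linarith
        qed
        have w_le: "w i j \<le> 0" if "i < n" "j < n" for i j
          using network_entry(1)[OF net that] cross_neg[OF that]
          by (cases "x i = x j") (auto simp: w_def mult_le_0_iff)
        have "w i j < 0"
          using cross_neg[OF i j ne] adj ne by (simp add: w_def mult_less_0_iff)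
        then have "(\<Sum>j<n. w i j) < 0"
          using w_le i j sum_strict_mono_ex1[of "{..<n}" "w i" "\<lambda>_. 0"] by auto
        moreover have "(\<Sum>j<n. w i j) \<le> 0" if "i < n" for i
          using w_le that by (intro sum_nonpos) auto
        ultimately have "(\<Sum>i<n. \<Sum>j<n. w i j) < 0"
          using i sum_strict_mono_ex1[of "{..<n}" "\<lambda>i. \<Sum>j<n. w i j" "\<lambda>_. 0"] by auto
        then show False
          using form[of x] by (simp add: w_def)
      qed
      have same_sign: "cos (\<psi> i) * cos (\<psi> j) > 0" if "i < n" "j < n" for i j
      proof -
        have "x i = x j"
          using edge_const[of x i j] x_edge that by blast
        moreover have "cos (\<psi> i) \<noteq> 0" "cos (\<psi> j) \<noteq> 0"
          using cos_large[OF that(1)] cos_large[OF that(2)] by auto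
        ultimately show ?thesis
          by (auto simp: x_def zero_less_mult_iff split: if_splits)
      qed

      \<comment> \<open>The property of having maximal tangent spreads along edges, hence to every node.\<close>
      have "Max ((\<lambda>i. tan (\<psi> i)) ` {..<n}) \<in> (\<lambda>i. tan (\<psi> i)) ` {..<n}"
        using i0 by (intro Max_in) auto
      then obtain p where p: "p < n" and "tan (\<psi> p) = Max ((\<lambda>i. tan (\<psi> i)) ` {..<n})"
        by auto
      then have p_max: "tan (\<psi> j) \<le> tan (\<psi> p)" if "j < n" for j
        using that by simp
      have "(tan (\<psi> i) = tan (\<psi> p)) = (tan (\<psi> j) = tan (\<psi> p))"
        if "i < n" "j < n" "A $$ (i, j) = 1" for i j
      proof -
        have "tan (\<psi> l) = tan (\<psi> p)"
          if l: "l < n" and l': "l' < n" and adj: "A $$ (l', l) = 1" and top: "tan (\<psi> l') = tan (\<psi> p)"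
          for l l'
          using equilibrium_tan_max[where \<psi> = \<psi>, OF net l' same_sign[OF l'] _ _ l adj] eq[OF l'] p_max top
          by (simp add: \<psi>_diff)
        then show ?thesis
          using network_entry(2)[OF net that(1,2)] that by auto
      qed
      then have tan_eq: "tan (\<psi> i) = tan (\<psi> p)" if "i < n" for i
        using edge_const[of "\<lambda>i. tan (\<psi> i) = tan (\<psi> p)" i p] p that by blast

      have "tan (\<psi> j0) = tan (\<psi> i0)"
        using tan_eq i0 j0 by simp
      moreover have "cos (\<psi> i0) \<noteq> 0" "cos (\<psi> j0) \<noteq> 0"
        using same_sign[OF i0 j0] by auto
      ultimately have "sin (\<phi> j0 - \<phi> i0) = 0"
        unfolding \<psi>_diff[symmetric] by (simp add: sin_diff tan_def field_simps)
      moreover have "cos (\<phi> j0 - \<phi> i0) > 0"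
        using cos_diff_sign[OF i0 j0] same_sign[OF i0 j0] by (rule zero_less_mult_pos2)
      ultimately have "cos (\<phi> j0 - \<phi> i0) = 1"
        using sin_zero_abs_cos_one by fastforce
      then obtain z :: int where "\<phi> j0 - \<phi> i0 = real_of_int z * 2 * pi"
        unfolding cos_one_2pi_int by blast
      then show ?thesis
        unfolding \<phi>_def rcong_altdef by (intro exI[of _ "- z"]) simp
    qed simp
  qed
  show ?thesis
    using zero by blast
qed

end
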